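(* Let $G=(V,E)$ be an undirected graph with $|V|=2n$ and let $P_G\subseteq\mathbb{R}^E$ be its perfect matching polytope. Then $P_G$ is $\tau$-wide for $\tau=1/(3\sqrt{|E|})$, i.e., for every vertex $\chi_M$ of $P_G$, the normal cone $N_{\chi_M}=\{c\in\mathbb{R}^E : \langle c,\chi_M\rangle=\max_{x\in P_G}\langle c,x\rangle\}$ contains a Euclidean ball of radius $\tau$ whose center lies on the unit sphere of $\mathbb{R}^E$.
   Context: The perfect matching polytope $P_G$ is the convex hull of the characteristic vectors $\chi_M\in\{0,1\}^E$ of the perfect matchings $M\subseteq E$ of $G$. *)

theory Defs
  imports "HOL-Analysis.Analysis"
begin

text \<open>
  The edge set is the finite index type \<open>'e\<close>, so that \<open>\<real>\<^sup>E\<close> is \<open>real ^ 'e\<close> with its Euclidean norm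
  and \<open>\<bar>E\<bar> = CARD('e)\<close>; \<open>ends e\<close> is the set of the two endpoints of \<open>e\<close>.
  Loops are excluded. Parallel edges are allowed; simple graphs are the case of injective \<open>ends\<close>.
\<close>

definition undirected_graph :: "'v set \<Rightarrow> ('e::finite \<Rightarrow> 'v set) \<Rightarrow> bool" where
  "undirected_graph V ends \<longleftrightarrow> finite V \<and> (\<forall>e. ends e \<subseteq> V \<and> card (ends e) = 2)"

definition perfect_matching :: "'v set \<Rightarrow> ('e::finite \<Rightarrow> 'v set) \<Rightarrow> 'e set \<Rightarrow> bool" where
  "perfect_matching V ends M \<longleftrightarrow> (\<forall>v\<in>V. \<exists>!e. e \<in> M \<and> v \<in> ends e)"

definition char_vec :: "'e set \<Rightarrow> real ^ ('e::finite)" where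
  "char_vec M = (\<chi> e. if e \<in> M then 1 else 0)"

definition perfect_matching_polytope :: "'v set \<Rightarrow> ('e::finite \<Rightarrow> 'v set) \<Rightarrow> (real ^ 'e) set" where
  "perfect_matching_polytope V ends = convex hull {char_vec M |M. perfect_matching V ends M}"

text \<open>For a nonempty compact \<open>P\<close>, in particular a nonempty polytope, the supremum is a maximum.\<close>

definition normal_cone :: "'a::euclidean_space set \<Rightarrow> 'a \<Rightarrow> 'a set" where
  "normal_cone P v = {c. c \<bullet> v = (SUP x\<in>P. c \<bullet> x)}"

definition wide :: "real \<Rightarrow> 'a::euclidean_space set \<Rightarrow> bool" where
  "wide \<tau> P \<longleftrightarrow>
    (\<forall>v. v extreme_point_of P \<longrightarrow> (\<exists>c \<in> sphere 0 1. cball c \<tau> \<subseteq> normal_cone P v))"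

end

theory Submission
  imports Defs
begin

text \<open>
  Only the fact that the vertices are 0/1 vectors matters. With \<open>m = \<bar>E\<bar>\<close> and the centre
  \<open>c = (2 \<chi>\<^sub>M - 1) / sqrt m\<close>, every 0/1 vector \<open>x\<close> satisfies
  \<open>\<langle>c, \<chi>\<^sub>M - x\<rangle> = \<parallel>\<chi>\<^sub>M - x\<parallel>\<^sup>2 / sqrt m\<close>, and \<open>\<parallel>\<chi>\<^sub>M - x\<parallel> \<ge> 1\<close> unless \<open>x = \<chi>\<^sub>M\<close>. Hence, by
  Cauchy--Schwarz, moving \<open>c\<close> by at most \<open>1 / sqrt m\<close> leaves \<open>\<chi>\<^sub>M\<close> a maximizer.
\<close>

text \<open>A half-space is convex, so a linear bound on the generators passes to the hull; it is
  attained at \<open>v\<close>, which makes the supremum a maximum.\<close>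

lemma normal_cone_convex_hullI:
  assumes "v \<in> S" and "\<And>x. x \<in> S \<Longrightarrow> c \<bullet> x \<le> c \<bullet> v"
  shows "c \<in> normal_cone (convex hull S) v"
proof -
  have "convex hull S \<subseteq> {x. c \<bullet> x \<le> c \<bullet> v}"
    using assms(2) by (intro hull_minimal) (auto simp: convex_halfspace_le)
  then have "(SUP x\<in>convex hull S. c \<bullet> x) = c \<bullet> v"
    using assms(1) by (intro cSup_eq_maximum) (auto simp: hull_inc)
  then show ?thesis
    by (simp add: normal_cone_def)
qed

lemma wide_antimono: "wide \<tau> P \<Longrightarrow> \<sigma> \<le> \<tau> \<Longrightarrow> wide \<sigma> P"
  unfolding wide_def by (meson order_trans subset_cball)

lemma norm_char_vec_diff_ge_1:
  fixes M N :: "'e::finite set"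
  assumes "char_vec M \<noteq> char_vec N"
  shows "1 \<le> norm (char_vec M - char_vec N)"
proof -
  obtain e where "char_vec M $ e \<noteq> char_vec N $ e"
    using assms by (auto simp: vec_eq_iff)
  then have "\<bar>(char_vec M - char_vec N) $ e\<bar> = 1"
    by (auto simp: char_vec_def split: if_splits)
  then show ?thesis
    by (metis component_le_norm_cart)
qed

text \<open>Where the two vectors differ, the sign vector has the sign of the difference, whose
  entries are 0 or \<plusminus>1; so the products are the squares, coordinate by coordinate.\<close>

lemma inner_sign_vec_char_vec_diff:
  fixes M N :: "'e::finite set"
  shows "(2 *\<^sub>R char_vec M - 1) \<bullet> (char_vec M - char_vec N) = (norm (char_vec M - char_vec N))\<^sup>2"
  unfolding power2_norm_eq_inner inner_vec_def
  by (intro sum.cong) (auto simp: char_vec_def)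

lemma norm_sign_vec:
  fixes M :: "'e::finite set"
  shows "norm (2 *\<^sub>R char_vec M - 1 :: real ^ 'e) = sqrt (real CARD('e))"
proof -
  have "((2 *\<^sub>R char_vec M - 1 :: real ^ 'e) $ e)\<^sup>2 = 1" for e
    by (simp add: char_vec_def)
  then show ?thesis
    by (simp add: norm_vec_def L2_set_def)
qed

lemma wide_convex_hull_char_vec:
  fixes F :: "'e::finite set set"
  shows "wide (1 / sqrt (real CARD('e))) (convex hull (char_vec ` F))"
  unfolding wide_def
proof (intro allI impI)
  define s where "s = sqrt (real CARD('e))"
  have "0 < s"
    by (simp add: s_def)
  fix v assume "v extreme_point_of convex hull (char_vec ` F)"
  then obtain M where M: "M \<in> F" "v = char_vec M"
    using extreme_point_of_convex_hull by blast
  define c where "c = (1 / s) *\<^sub>R (2 *\<^sub>R v - 1)"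
  have "norm c = 1"
    using \<open>0 < s\<close> by (simp add: c_def M(2) norm_sign_vec flip: s_def)
  moreover have "cball c (1 / s) \<subseteq> normal_cone (convex hull (char_vec ` F)) v"
  proof
    fix d assume "d \<in> cball c (1 / s)"
    then have d: "norm (c - d) \<le> 1 / s"
      by (simp add: dist_norm)
    have "d \<bullet> char_vec N \<le> d \<bullet> v" for N
    proof -
      define r where "r = norm (v - char_vec N)"
      \<comment> \<open>The gap in the possible distances lets the quadratic gain of
        \<open>c\<close> absorb the linear loss from replacing \<open>c\<close> by
        \<open>d\<close>.\<close>
      have "r = 0 \<or> 1 \<le> r"
        using norm_char_vec_diff_ge_1[of M N] by (auto simp: r_def M(2))
      then have "r \<le> r\<^sup>2"
        by (auto simp: power2_eq_square)
      have "(c - d) \<bullet> (v - char_vec N) \<le> (1 / s) * r"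
        using norm_cauchy_schwarz[of "c - d"] mult_right_mono[OF d, of r]
        by (fastforce simp: r_def intro: order_trans)
      also have "\<dots> \<le> (1 / s) * r\<^sup>2"
        using \<open>r \<le> r\<^sup>2\<close> \<open>0 < s\<close> by (intro mult_left_mono) auto
      also have "\<dots> = c \<bullet> (v - char_vec N)"
        by (simp add: c_def r_def M(2) inner_sign_vec_char_vec_diff)
      \<comment> \<open>Cancelling the \<open>c\<close> terms leaves
        \<open>0 \<le> d \<bullet> (v - char_vec N)\<close>.\<close>
      finally show ?thesis
        by (simp add: inner_diff_left inner_diff_right)
    qed
    then show "d \<in> normal_cone (convex hull (char_vec ` F)) v"
      using M by (intro normal_cone_convex_hullI) auto
  qed
  ultimately show "\<exists>c\<in>sphere 0 1.
      cball c (1 / sqrt (real CARD('e))) \<subseteq> normal_cone (convex hull (char_vec ` F)) v"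
    unfolding s_def by (intro bexI[of _ c]) auto
qed

theorem theorem33:
  fixes V :: "'v set" and ends :: "'e::finite \<Rightarrow> 'v set" and n :: nat
  assumes "undirected_graph V ends"
    and "card V = 2 * n"
  shows "wide (1 / (3 * sqrt (real CARD('e)))) (perfect_matching_polytope V ends)"
proof -
  have "perfect_matching_polytope V ends = convex hull (char_vec ` {M. perfect_matching V ends M})"
    by (simp add: perfect_matching_polytope_def setcompr_eq_image)
  \<comment> \<open>The ball found above has three times the required radius, so it is shrunk about
    the same center.\<close>
  moreover have "1 / (3 * sqrt (real CARD('e))) \<le> 1 / sqrt (real CARD('e))"
    by (simp add: divide_simps)
  ultimately show ?thesis
    using wide_antimono[OF wide_convex_hull_char_vec] by metis
qed

end
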